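(* For each $n \geq 1$, let $\theta_1^{(n)},\ldots,\theta_n^{(n)}$ be random variables taking values in $[0,2\pi)$ (not assumed independent or identically distributed), and set $$p_n(z) := \prod_{j=1}^n \left(z - e^{i\theta_j^{(n)}}\right).$$ Assume: (i) $$\lim_{\delta\searrow 0}\limsup_{n\to\infty}\mathbb{P}\left(\left|\sum_{j=1}^n e^{-i\theta_j^{(n)}}\right|\leq\delta\right)=0;$$ (ii) for (Lebesgue) almost every $z\in\mathbb{D}:=\{w\in\mathbb{C}:|w|<1\}$, $$\lim_{\delta\searrow 0}\limsup_{n\to\infty}\mathbb{P}\left(\left|\sum_{m=0}^{\lfloor\log^2 n\rfloor}z^m\sum_{j=1}^n e^{-i\theta_j^{(n)}(m+1)}\right|\leq\delta\right)=0;$$ (iii) for all integers $m\geq 1$, $\frac1n\sum_{j=1}^n e^{i\theta_j^{(n)}m}\to 0$ in probability as $n\to\infty$. Then the empirical measure $\mu_{p_n}'$ of the critical points of $p_n$ converges weakly in probability as $n\to\infty$ to the uniform probability distribution on the unit circle centered at the origin in $\mathbb{C}$.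
   Context: A critical point of a polynomial is a root of its derivative. For a polynomial $f$ of degree $d\ge1$, $\mu_f:=\frac1d\sum_{z\in\mathbb{C}:f(z)=0}\mathcal{N}_f(z)\,\delta_z$, where $\mathcal{N}_f(z)$ is the multiplicity of the zero $z$ and $\delta_z$ the unit point mass; $\mu_{p_n}':=\mu_{p_n'}$ (defined for $n\ge2$). Here $\log^2 n=(\log n)^2$. Random probability measures $\mu_n$ on $\mathbb{C}$ converge weakly in probability to a probability measure $\mu$ on $\mathbb{C}$ if for every bounded continuous $f:\mathbb{C}\to\mathbb{R}$ and every $\varepsilon>0$, $\lim_{n\to\infty}\mathbb{P}\left(\left|\int f\,d\mu_n-\int f\,d\mu\right|>\varepsilon\right)=0$. *)

theory Defs
  imports "HOL-Probability.Probability" "HOL-Computational_Algebra.Fundamental_Theorem_Algebra"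
begin

definition circle_poly :: "nat \<Rightarrow> (nat \<Rightarrow> real) \<Rightarrow> complex poly" where
  "circle_poly n t = (\<Prod>j=1..n. [:- cis (t j), 1:])"

(* point_measure lives on the power set of the set of zeros; distr moves it to the Borel sets. *)
definition root_measure :: "complex poly \<Rightarrow> complex measure" where
  "root_measure p = distr
     (point_measure {z. poly p z = 0} (\<lambda>z. ennreal (real (order z p) / real (degree p))))
     borel (\<lambda>z. z)"

definition crit_measure :: "complex poly \<Rightarrow> complex measure" where
  "crit_measure p = root_measure (pderiv p)"

definition unit_circle_uniform :: "complex measure" where
  "unit_circle_uniform = distr (uniform_measure lborel {0..<2 * pi}) borel cis"

(* Only the laws of the individual mu n matter, so each may live on its own space M n.
   The events are meant to be measurable: the measure of a non-measurable set is 0. For critical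
   points of a monic polynomial of fixed degree >= 2 they are, the integral of a bounded continuous
   f being a continuous function of the coefficients. *)
definition converges_weakly_in_prob ::
  "(nat \<Rightarrow> 'a measure) \<Rightarrow> (nat \<Rightarrow> 'a \<Rightarrow> complex measure) \<Rightarrow> complex measure \<Rightarrow> bool" where
  "converges_weakly_in_prob M \<mu> \<nu> \<longleftrightarrow>
     (\<forall>f :: complex \<Rightarrow> real. continuous_on UNIV f \<longrightarrow> bounded (range f) \<longrightarrow>
       (\<forall>\<epsilon>>0. (\<lambda>n. \<P>(\<omega> in M n. \<bar>integral\<^sup>L (\<mu> n \<omega>) f - integral\<^sup>L \<nu> f\<bar> > \<epsilon>)) \<longlonglongrightarrow> 0))"

definition tends_to_zero_in_prob :: "(nat \<Rightarrow> 'a measure) \<Rightarrow> (nat \<Rightarrow> 'a \<Rightarrow> complex) \<Rightarrow> bool" where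
  "tends_to_zero_in_prob M X \<longleftrightarrow>
     (\<forall>\<epsilon>>0. (\<lambda>n. \<P>(\<omega> in M n. cmod (X n \<omega>) > \<epsilon>)) \<longlonglongrightarrow> 0)"

definition no_mass_near_zero :: "(nat \<Rightarrow> 'a measure) \<Rightarrow> (nat \<Rightarrow> 'a \<Rightarrow> complex) \<Rightarrow> bool" where
  "no_mass_near_zero M X \<longleftrightarrow>
     ((\<lambda>\<delta>::real. limsup (\<lambda>n. ereal (\<P>(\<omega> in M n. cmod (X n \<omega>) \<le> \<delta>)))) \<longlongrightarrow> 0) (at_right 0)"

lemma sets_root_measure [simp]: "sets (root_measure p) = sets borel"
  and space_root_measure [simp]: "space (root_measure p) = UNIV"
  by (simp_all add: root_measure_def)

lemma emeasure_root_measure: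
  assumes "p \<noteq> 0" "A \<in> sets borel"
  shows "emeasure (root_measure p) A =
    (\<Sum>z | poly p z = 0. ennreal (real (order z p) / real (degree p)) * indicator A z)"
proof -
  have fin: "finite {z. poly p z = 0}"
    using assms(1) by (rule poly_roots_finite)
  have "emeasure (root_measure p) A = emeasure (point_measure {z. poly p z = 0}
      (\<lambda>z. ennreal (real (order z p) / real (degree p)))) (A \<inter> {z. poly p z = 0})"
    using assms(2) by (simp add: root_measure_def emeasure_distr space_point_measure measurable_def
        sets_point_measure)
  also have "\<dots> = (\<Sum>z\<in>A \<inter> {z. poly p z = 0}. ennreal (real (order z p) / real (degree p)))"
    by (rule emeasure_point_measure_finite) (use fin in auto)
  also have "\<dots> = (\<Sum>z | poly p z = 0. ennreal (real (order z p) / real (degree p)) * indicator A z)"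
    using fin by (intro sum.mono_neutral_cong_left) (auto simp: indicator_def)
  finally show ?thesis .
qed

lemma prob_space_root_measure:
  assumes "degree p \<ge> 1"
  shows "prob_space (root_measure p)"
proof
  have p: "p \<noteq> 0" using assms by auto
  have "(\<Sum>z | poly p z = 0. order z p) = size (proots p)"
    using p by (simp add: size_multiset_overloaded_eq)
  also have "\<dots> = degree p" by (rule size_proots_complex)
  finally have "(\<Sum>z | poly p z = 0. real (order z p) / real (degree p)) = 1"
    using assms by (simp flip: sum_divide_distrib of_nat_sum)
  then show "emeasure (root_measure p) (space (root_measure p)) = 1"
    using p by (simp add: emeasure_root_measure sum_ennreal)
qed

lemma prob_space_unit_circle_uniform: "prob_space unit_circle_uniform"
proof -
  have "continuous_on UNIV cis" by (intro continuous_intros)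
  then have "cis \<in> borel_measurable borel" by (rule borel_measurable_continuous_onI)
  then show ?thesis unfolding unit_circle_uniform_def
    by (intro prob_space.prob_space_distr prob_space_uniform_measure)
      (auto simp: measurable_def uniform_measure_def)
qed

end

theory Submission
  imports Defs "HOL-Real_Asymp.Real_Asymp"
begin

text \<open>
  A measure on the closed unit disc whose moments \<open>\<integral> z\<^sup>m\<close> vanish for all \<open>m \<ge> 1\<close> and which lives on the unit
  circle is the uniform distribution. The proof verifies these two properties, asymptotically, for the critical
  points \<open>w\<^sub>1, ..., w\<^bsub>n-1\<^esub>\<close> of a polynomial with zeros \<open>z\<^sub>1, ..., z\<^sub>n\<close> on the unit circle.
  
  They are close to the circle because of the value of the derivative at the origin. By Gauss--Lucas
  (\<open>Gauss_Lucas_unit_disc\<close>) all \<open>|w\<^sub>k| \<le> 1\<close>, and \<open>n \<Prod>|w\<^sub>k| = |p'(0)| = |\<Sum> 1 / z\<^sub>j|\<close>. If the last sum exceeds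
  \<open>\<delta>\<close>, then \<open>\<Sum> (1 - |w\<^sub>k|) \<le> \<Sum> ln (1 / |w\<^sub>k|) \<le> ln (n / \<delta>) = o(n)\<close> (\<open>critical_points_near_unit_circle\<close>).
  
  Their moments are those of the zeros up to \<open>O(1/n)\<close>. Newton's identities for \<open>p\<close> and for \<open>p'\<close> combine to a
  recursion between the power sums of the zeros and of the critical points (\<open>power_sums_critical_points\<close>),
  and this recursion bounds the difference of the \<open>m\<close>-th power sums by \<open>2\<^sup>m\<^sup>+\<^sup>1\<close>, whatever the degree
  (\<open>power_sum_critical_points_diff_le\<close>).
  
  Weyl's criterion in the form \<open>Weyl_criterion_disc_uniform\<close> turns both facts into a deterministic statement
  (\<open>integral_crit_measure_close\<close>): for large \<open>n\<close> the integral of the test function is within \<open>\<epsilon>\<close> of its limit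
  unless \<open>|\<Sum> 1 / z\<^sub>j| \<le> \<delta>\<close> or one of finitely many empirical moments of the zeros is not small. The
  hypotheses (i) and (iii) make these exceptional events improbable.
\<close>

section \<open>Power sums of zeros and of critical points\<close>

text \<open>
  Logarithmic differentiation of \<open>\<Prod>(1 - a\<^sub>i X)\<close>, multiplied out so that no division is needed: the sum of the
  geometric series \<open>1 / (1 - a\<^sub>i X)\<close> generates the power sums of the \<open>a\<^sub>i\<close>.
\<close>

lemma Newton_identity_fps:
  fixes a :: "'i \<Rightarrow> 'a :: field"
  assumes "finite I"
  defines "F \<equiv> \<Prod>i\<in>I. 1 - fps_const (a i) * fps_X"
  shows "of_nat (card I) * F - fps_X * fps_deriv F = Abs_fps (\<lambda>m. \<Sum>i\<in>I. a i ^ m) * F"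
  unfolding F_def using assms(1)
proof (induction I rule: finite_induct)
  case empty
  have "Abs_fps (\<lambda>m. 0 :: 'a) = 0" by (simp add: fps_eq_iff)
  then show ?case by simp
next
  case (insert i I)
  let ?F = "\<Prod>i\<in>I. 1 - fps_const (a i) * fps_X"
  let ?P = "Abs_fps (\<lambda>m. \<Sum>i\<in>I. a i ^ m)"
  let ?l = "1 - fps_const (a i) * fps_X"
  let ?g = "Abs_fps (\<lambda>m. a i ^ m)"
  have geom: "?g * ?l = 1"
  proof (rule fps_ext)
    fix n
    have "?g * ?l = ?g - fps_const (a i) * (fps_X * ?g)" by (simp add: algebra_simps)
    then show "fps_nth (?g * ?l) n = fps_nth 1 n" by (cases n) simp_all
  qed
  have split: "Abs_fps (\<lambda>m. \<Sum>i\<in>insert i I. a i ^ m) = ?g + ?P"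
    using insert by (simp add: fps_eq_iff)
  have "of_nat (card (insert i I)) * (\<Prod>i\<in>insert i I. 1 - fps_const (a i) * fps_X)
      - fps_X * fps_deriv (\<Prod>i\<in>insert i I. 1 - fps_const (a i) * fps_X)
      = ?l * (of_nat (card I) * ?F - fps_X * fps_deriv ?F) + ?F"
    using insert by (simp add: algebra_simps)
  also have "\<dots> = ?l * (?P * ?F) + (?g * ?l) * ?F"
    unfolding insert.IH geom by simp
  also have "\<dots> = (?g + ?P) * (?l * ?F)"
    by (simp add: algebra_simps)
  finally show ?case using insert split by simp
qed

text \<open>
  With \<open>R(X) = X\<^sup>n p(1/X)\<close> the product rule gives \<open>X\<^sup>n\<^sup>-\<^sup>1 p'(1/X) = n R - X R'\<close>. This is the left-hand side of
  Newton's identity, which is why the reflected derivative factors as the power sum series of the zeros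
  times \<open>R\<close>.
\<close>

lemma fps_reflect_poly_pderiv:
  fixes p :: "'a :: field_char_0 poly"
  shows "fps_of_poly (reflect_poly (pderiv p)) =
    of_nat (degree p) * fps_of_poly (reflect_poly p) - fps_X * fps_deriv (fps_of_poly (reflect_poly p))"
proof (rule fps_ext)
  fix i
  have "fps_nth (of_nat (degree p) * F) i = of_nat (degree p) * fps_nth F i" for F :: "'a fps"
    by (metis fps_mult_left_const_nth fps_of_nat)
  then show "fps_nth (fps_of_poly (reflect_poly (pderiv p))) i = fps_nth (of_nat (degree p) * fps_of_poly (reflect_poly p)
      - fps_X * fps_deriv (fps_of_poly (reflect_poly p))) i"
    by (cases i; cases "i < degree p"; cases "i = degree p")
      (auto simp: coeff_reflect_poly degree_pderiv coeff_pderiv of_nat_diff algebra_simps Suc_diff_Suc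
        Suc_diff_le pderiv_eq_0_iff coeff_eq_0)
qed

lemma fps_reflect_poly_prod_linear:
  fixes a :: "'i \<Rightarrow> 'a :: field"
  shows "fps_of_poly (reflect_poly (\<Prod>i\<in>I. [:- a i, 1:])) = (\<Prod>i\<in>I. 1 - fps_const (a i) * fps_X)"
proof -
  have "reflect_poly [:- b, 1:] = [:1, - b:]" for b :: 'a
    by (cases "b = 0") (simp_all add: reflect_poly_def)
  then show ?thesis by (simp add: reflect_poly_prod fps_of_poly_prod fps_of_poly_linear' flip: fps_const_neg)
qed

lemma degree_prod_linear:
  fixes a :: "'i \<Rightarrow> 'a :: field"
  shows "degree (\<Prod>i\<in>I. [:- a i, 1:]) = card I"
  by (subst degree_prod_eq_sum_degree) auto

text \<open>
  Let \<open>A\<close> and \<open>B\<close> generate the power sums of the zeros and of the critical points, and let \<open>R\<close> and \<open>T\<close> be the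
  reflections of \<open>p\<close> and of \<open>p' / c\<close>. Newton's identity for \<open>p\<close> says \<open>c T = A R\<close>; inserting this into Newton's
  identity for \<open>p'\<close> and cancelling \<open>R\<close> leaves \<open>B A = A\<^sup>2 - A - X A'\<close>, whose coefficients are the claim.
\<close>

lemma power_sums_critical_points:
  fixes z w :: "'i \<Rightarrow> 'a :: field_char_0"
  assumes fin: "finite I" "finite K" and card: "card I = Suc (card K)"
    and fact: "pderiv (\<Prod>i\<in>I. [:- z i, 1:]) = smult c (\<Prod>k\<in>K. [:- w k, 1:])"
  shows "(\<Sum>k\<le>m. (\<Sum>i\<in>K. w i ^ k) * (\<Sum>i\<in>I. z i ^ (m - k))) =
    (\<Sum>k\<le>m. (\<Sum>i\<in>I. z i ^ k) * (\<Sum>i\<in>I. z i ^ (m - k))) - of_nat (m + 1) * (\<Sum>i\<in>I. z i ^ m)"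
proof -
  let ?p = "\<Prod>i\<in>I. [:- z i, 1:]"
  define R where "R = (\<Prod>i\<in>I. 1 - fps_const (z i) * fps_X)"
  define T where "T = (\<Prod>k\<in>K. 1 - fps_const (w k) * fps_X)"
  define A where "A = Abs_fps (\<lambda>m. \<Sum>i\<in>I. z i ^ m)"
  define B where "B = Abs_fps (\<lambda>m. \<Sum>i\<in>K. w i ^ m)"
  have A: "of_nat (Suc (card K)) * R - fps_X * fps_deriv R = A * R"
    using Newton_identity_fps[OF fin(1), of z] card by (simp add: R_def A_def)
  have B: "of_nat (card K) * T - fps_X * fps_deriv T = B * T"
    using Newton_identity_fps[OF fin(2), of w] by (simp add: T_def B_def)
  have "fps_const c * T = fps_of_poly (reflect_poly (pderiv ?p))"
    by (simp only: fact reflect_poly_smult fps_of_poly_smult fps_reflect_poly_prod_linear T_def)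
  also have "\<dots> = of_nat (Suc (card K)) * R - fps_X * fps_deriv R"
    using fps_reflect_poly_pderiv[of ?p]
    by (simp only: fps_reflect_poly_prod_linear degree_prod_linear card R_def)
  finally have T: "fps_const c * T = A * R" using A by simp
  have "1 - fps_const a * fps_X \<noteq> 0" for a :: 'a
  proof
    assume "1 - fps_const a * fps_X = 0"
    then have "fps_nth (1 - fps_const a * fps_X) 0 = 0" by simp
    then show False by simp
  qed
  then have "R \<noteq> 0" using fin(1) by (simp add: R_def)
  have "fps_const c * (B * T) = of_nat (card K) * (fps_const c * T) - fps_X * fps_deriv (fps_const c * T)"
    unfolding B[symmetric] by (simp add: algebra_simps)
  then have "B * (A * R) = of_nat (card K) * (A * R) - fps_X * fps_deriv (A * R)"
    unfolding T[symmetric] by (simp add: algebra_simps)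
  also have "\<dots> = A * (of_nat (Suc (card K)) * R - fps_X * fps_deriv R) - A * R - fps_X * fps_deriv A * R"
    by (simp add: algebra_simps)
  also have "\<dots> = (A * A - A - fps_X * fps_deriv A) * R"
    unfolding A by (simp add: algebra_simps)
  finally have "(B * A - (A * A - A - fps_X * fps_deriv A)) * R = 0"
    by (simp add: algebra_simps)
  with \<open>R \<noteq> 0\<close> have "B * A = A * A - A - fps_X * fps_deriv A"
    by simp
  then have "fps_nth (B * A) m = fps_nth (A * A) m - fps_nth A m - fps_nth (fps_X * fps_deriv A) m"
    by simp
  also have "fps_nth (fps_X * fps_deriv A) m = of_nat m * fps_nth A m"
    by (cases m) simp_all
  finally have "fps_nth (B * A) m = fps_nth (A * A) m - of_nat (m + 1) * fps_nth A m"
    by (simp add: algebra_simps)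
  then show ?thesis
    unfolding fps_mult_nth atLeast0AtMost by (simp add: A_def B_def)
qed

text \<open>
  For zeros in the closed unit disc, a power sum of the critical points stays within a distance of the
  corresponding power sum of the zeros that does not depend on the degree \<open>n\<close>. Writing \<open>d\<^sub>k\<close> for the differences,
  the recursion above reads \<open>n d\<^sub>m = - (m + 1) P\<^sub>m - \<Sum>\<^bsub>k<m\<^esub> d\<^sub>k P\<^bsub>m-k\<^esub>\<close>, and since each \<open>P\<^sub>k\<close> has modulus at most \<open>n\<close>
  the factor \<open>n\<close> cancels: \<open>|d\<^sub>m| \<le> (m + 1) + \<Sum>\<^bsub>k<m\<^esub> |d\<^sub>k|\<close>. The bound \<open>2\<^sup>m\<^sup>+\<^sup>1 - 1\<close> solves this with equality.
\<close>

lemma power_sum_critical_points_diff_le: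
  fixes z w :: "'i \<Rightarrow> complex"
  assumes fin: "finite I" "finite K" and card: "card I = Suc (card K)"
    and fact: "pderiv (\<Prod>i\<in>I. [:- z i, 1:]) = smult c (\<Prod>k\<in>K. [:- w k, 1:])"
    and z: "\<And>i. i \<in> I \<Longrightarrow> cmod (z i) \<le> 1"
  shows "cmod ((\<Sum>i\<in>K. w i ^ m) - (\<Sum>i\<in>I. z i ^ m)) \<le> 2 ^ (m + 1) - 1"
proof (induction m rule: less_induct)
  case (less m)
  let ?P = "\<lambda>m. \<Sum>i\<in>I. z i ^ m" and ?Q = "\<lambda>m. \<Sum>i\<in>K. w i ^ m"
  define n where "n = real (card I)"
  have n: "n > 0" using card by (simp add: n_def)
  have P: "cmod (?P k) \<le> n" for k
  proof -
    have "cmod (?P k) \<le> (\<Sum>i\<in>I. 1)"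
      by (rule sum_norm_le) (simp add: norm_power power_le_one z)
    then show ?thesis by (simp add: n_def)
  qed
  have "(\<Sum>k\<le>m. (?Q k - ?P k) * ?P (m - k)) = - (of_nat (m + 1) * ?P m)"
    using power_sums_critical_points[OF fin card fact, of m]
    by (simp add: left_diff_distrib sum_subtractf)
  moreover have "(\<Sum>k<m. (?Q k - ?P k) * ?P (m - k)) + (?Q m - ?P m) * of_real n =
      (\<Sum>k\<le>m. (?Q k - ?P k) * ?P (m - k))"
    by (simp add: lessThan_Suc_atMost[symmetric] n_def)
  ultimately have "(\<Sum>k<m. (?Q k - ?P k) * ?P (m - k)) + (?Q m - ?P m) * of_real n =
      - (of_nat (m + 1) * ?P m)" by simp
  then have eq: "(?Q m - ?P m) * of_real n =
      - (of_nat (m + 1) * ?P m) - (\<Sum>k<m. (?Q k - ?P k) * ?P (m - k))"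
    by (simp only: eq_diff_eq add.commute)
  have "cmod (?Q m - ?P m) * n = cmod ((?Q m - ?P m) * of_real n)"
    unfolding norm_mult norm_of_real using n by simp
  also have "\<dots> = cmod (- (of_nat (m + 1) * ?P m) - (\<Sum>k<m. (?Q k - ?P k) * ?P (m - k)))"
    by (simp only: eq)
  also have "\<dots> \<le> real (m + 1) * n + (\<Sum>k<m. (2 ^ (k + 1) - 1) * n)"
  proof (rule order_trans[OF norm_triangle_ineq4] add_mono)+
    show "cmod (- (of_nat (m + 1) * ?P m)) \<le> real (m + 1) * n"
      unfolding norm_minus_cancel norm_mult norm_of_nat using P by (intro mult_left_mono) auto
    show "cmod (\<Sum>k<m. (?Q k - ?P k) * ?P (m - k)) \<le> (\<Sum>k<m. (2 ^ (k + 1) - 1) * n)"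
      by (rule sum_norm_le) (auto simp: norm_mult intro!: mult_mono less.IH[unfolded Suc_eq_plus1[symmetric]] P simp del: power_Suc)
  qed
  also have "\<dots> = (2 ^ (m + 1) - 1) * n"
  proof -
    have "(\<Sum>k<m. 2 ^ (k + 1) - 1 :: real) = 2 ^ (m + 1) - 2 - real m"
      by (induction m) auto
    then show ?thesis by (simp only: sum_distrib_right[symmetric]) (simp add: algebra_simps)
  qed
  finally show ?case using n by simp
qed

section \<open>Location of the critical points\<close>

lemma poly_pderiv_prod_linear:
  fixes z :: "'i \<Rightarrow> complex"
  assumes "finite I" "\<And>i. i \<in> I \<Longrightarrow> x \<noteq> z i"
  shows "poly (pderiv (\<Prod>i\<in>I. [:- z i, 1:])) x = (\<Prod>i\<in>I. x - z i) * (\<Sum>i\<in>I. 1 / (x - z i))"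
proof -
  have "prod (\<lambda>i. x - z i) (I - {i}) = (\<Prod>i\<in>I. x - z i) * (1 / (x - z i))" if "i \<in> I" for i
    using assms that by (subst prod.remove[of I i]) auto
  then show ?thesis
    using assms(1) by (simp add: pderiv_prod poly_sum poly_prod sum_distrib_left pderiv_pCons)
qed

text \<open>
  If \<open>|x| > 1 \<ge> |z\<^sub>i|\<close> then every \<open>x / (x - z\<^sub>i) = 1 / (1 - z\<^sub>i / x)\<close> has positive real part, so
  \<open>p'(x) / p(x) = \<Sum> 1 / (x - z\<^sub>i)\<close> cannot vanish.
\<close>

lemma Gauss_Lucas_unit_disc:
  fixes z :: "'i \<Rightarrow> complex"
  assumes "finite I" "I \<noteq> {}" and z: "\<And>i. i \<in> I \<Longrightarrow> cmod (z i) \<le> 1"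
    and x: "poly (pderiv (\<Prod>i\<in>I. [:- z i, 1:])) x = 0"
  shows "cmod x \<le> 1"
proof (rule ccontr)
  assume "\<not> cmod x \<le> 1"
  then have x1: "cmod x > 1" by simp
  have ne: "x \<noteq> z i" if "i \<in> I" for i using z[OF that] x1 by auto
  have "(\<Prod>i\<in>I. x - z i) \<noteq> 0" using ne assms(1) by auto
  with x have 0: "(\<Sum>i\<in>I. 1 / (x - z i)) = 0"
    using poly_pderiv_prod_linear[OF assms(1), where z = z and x = x] ne by auto
  have pos: "Re (x / (x - z i)) > 0" if i: "i \<in> I" for i
  proof -
    have "Re (z i * cnj x) \<le> cmod (z i) * cmod x"
      using complex_Re_le_cmod[of "z i * cnj x"] by (simp add: norm_mult)
    also have "\<dots> \<le> cmod x" using z[OF i] x1 by (simp add: mult_left_le_one_le)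
    also have "\<dots> < cmod x * cmod x" using x1 mult_strict_right_mono[OF x1, of "cmod x"] by linarith
    also have "\<dots> = Re (x * cnj x)" by (simp only: complex_norm_square[symmetric] power2_eq_square Re_complex_of_real)
    finally have "Re (z i * cnj x) < Re (x * cnj x)" .
    moreover have "Re (x * cnj (x - z i)) = Re (x * cnj x) - Re (z i * cnj x)"
      by (simp add: algebra_simps)
    ultimately have "Re (x * cnj (x - z i)) > 0" by linarith
    moreover have "x / (x - z i) = x * cnj (x - z i) / of_real ((cmod (x - z i))\<^sup>2)"
      using ne[OF i] by (subst complex_div_cnj) simp
    ultimately show ?thesis
      using ne[OF i] by (simp only: Re_divide_of_real) (simp add: zero_less_divide_iff)
  qed
  have "0 < (\<Sum>i\<in>I. Re (x / (x - z i)))" using assms(1,2) pos by (intro sum_pos) auto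
  also have "\<dots> = Re (x * (\<Sum>i\<in>I. 1 / (x - z i)))" by (simp add: sum_distrib_left)
  finally show False using 0 by simp
qed

section \<open>Polynomials in a complex variable and its conjugate\<close>

text \<open>
  The span of the monomials \<open>z\<^sup>a (cnj z)\<^sup>b\<close>. A convergence statement that is linear in the test function is proved
  by induction over this predicate, and it reaches every real polynomial in \<open>Re z\<close> and \<open>Im z\<close>.
\<close>

inductive conj_polynomial :: "(complex \<Rightarrow> complex) \<Rightarrow> bool" where
  monomial: "conj_polynomial (\<lambda>z. c * z ^ a * cnj z ^ b)"
| add: "conj_polynomial f \<Longrightarrow> conj_polynomial g \<Longrightarrow> conj_polynomial (\<lambda>z. f z + g z)"

lemma conj_polynomial_mult:
  assumes "conj_polynomial f" "conj_polynomial g"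
  shows "conj_polynomial (\<lambda>z. f z * g z)"
  using assms(1)
proof (induction f)
  case (monomial c a b)
  from assms(2) show ?case
  proof (induction g)
    case (monomial d k l)
    have "(\<lambda>z. c * z ^ a * cnj z ^ b * (d * z ^ k * cnj z ^ l)) =
        (\<lambda>z. (c * d) * z ^ (a + k) * cnj z ^ (b + l))"
      by (simp add: fun_eq_iff power_add algebra_simps)
    then show ?case by (simp only: conj_polynomial.monomial)
  next
    case (add g h)
    then show ?case by (simp only: distrib_left conj_polynomial.add)
  qed
next
  case (add f h)
  then show ?case by (simp only: distrib_right conj_polynomial.add)
qed

lemma conj_polynomial_of_real:
  "real_polynomial_function g \<Longrightarrow> conj_polynomial (\<lambda>z. complex_of_real (g z))"
proof (induction g rule: real_polynomial_function.induct)
  case (linear h)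
  interpret bounded_linear h by fact
  \<comment> \<open>A real linear form on the plane is \<open>\<alpha> z + cnj (\<alpha> z)\<close> for this \<open>\<alpha>\<close>.\<close>
  define \<alpha> where "\<alpha> = Complex (h 1 / 2) (- h \<i> / 2)"
  have "h z = h (Re z *\<^sub>R 1 + Im z *\<^sub>R \<i>)" for z
    by (rule arg_cong[where f = h]) (simp add: complex_eq_iff)
  also have "h (Re z *\<^sub>R 1 + Im z *\<^sub>R \<i>) = Re z * h 1 + Im z * h \<i>" for z
    by (simp only: add scaleR real_scaleR_def)
  finally have h: "h z = Re z * h 1 + Im z * h \<i>" for z .
  have "(\<lambda>z. complex_of_real (h z)) = (\<lambda>z. \<alpha> * z ^ 1 * cnj z ^ 0 + cnj \<alpha> * z ^ 0 * cnj z ^ 1)"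
  proof
    fix z show "complex_of_real (h z) = \<alpha> * z ^ 1 * cnj z ^ 0 + cnj \<alpha> * z ^ 0 * cnj z ^ 1"
      by (subst h) (simp add: complex_eq_iff \<alpha>_def algebra_simps)
  qed
  then show ?case by (simp only: conj_polynomial.intros)
next
  case (const c)
  then show ?case using conj_polynomial.monomial[of "complex_of_real c" 0 0] by simp
qed (simp_all add: conj_polynomial.add conj_polynomial_mult)

section \<open>Integrals over the unit circle\<close>

lemma cis_measurable [measurable]: "cis \<in> borel_measurable borel"
  by (intro borel_measurable_continuous_onI continuous_intros)

lemma sets_unit_circle_uniform [simp, measurable_cong]: "sets unit_circle_uniform = sets borel"
  by (simp add: unit_circle_uniform_def)

lemma AE_unit_circle_uniform: "AE z in unit_circle_uniform. cmod z = 1"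
  unfolding unit_circle_uniform_def by (subst AE_distr_iff) (auto simp: uniform_measure_def)

lemma integrable_unit_circle_uniform:
  fixes f :: "complex \<Rightarrow> 'b :: euclidean_space"
  assumes "continuous_on UNIV f"
  shows "integrable unit_circle_uniform f"
proof -
  interpret prob_space unit_circle_uniform by (rule prob_space_unit_circle_uniform)
  have "bounded (f ` sphere 0 1)"
    by (intro compact_imp_bounded compact_continuous_image continuous_on_subset[OF assms]) auto
  then obtain B where B: "norm (f z) \<le> B" if "cmod z = 1" for z
    by (force simp: bounded_iff)
  have f [measurable]: "f \<in> borel_measurable borel"
    using assms by (rule borel_measurable_continuous_onI)
  show ?thesis
  proof (rule integrable_const_bound)
    show "AE z in unit_circle_uniform. norm (f z) \<le> B"
      using AE_unit_circle_uniform by eventually_elim (rule B)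
  qed measurable
qed

text \<open>
  The endpoint \<open>2\<pi>\<close> is a null set, so the integral over the half-open interval is one over a compact interval,
  to which the fundamental theorem of calculus applies.
\<close>

lemma integral_unit_circle_uniform:
  fixes f :: "complex \<Rightarrow> complex"
  assumes "continuous_on UNIV f"
    and F: "\<And>t. (F has_vector_derivative f (cis t)) (at t)"
  shows "integral\<^sup>L unit_circle_uniform f = (F (2 * pi) - F 0) / (2 * pi)"
proof -
  have f [measurable]: "f \<in> borel_measurable borel"
    using assms(1) by (rule borel_measurable_continuous_onI)
  have "integral\<^sup>L unit_circle_uniform f = integral\<^sup>L (uniform_measure lborel {0..<2 * pi}) (\<lambda>t. f (cis t))"
    unfolding unit_circle_uniform_def by (rule integral_distr) (auto simp: uniform_measure_def)
  also have "uniform_measure lborel {0..<2 * pi} = density lborel (\<lambda>t. ennreal (indicator {0..<2 * pi} t / (2 * pi)))"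
    unfolding uniform_measure_def
    by (intro arg_cong[where f = "density lborel"] ext) (simp add: divide_ennreal indicator_def flip: ennreal_1)
  also have "integral\<^sup>L \<dots> (\<lambda>t. f (cis t)) =
      (\<integral>t. (indicator {0..<2 * pi} t / (2 * pi)) *\<^sub>R f (cis t) \<partial>lborel)"
    by (rule integral_density) auto
  also have "\<dots> = (\<integral>t. (indicator {0..2 * pi} t *\<^sub>R f (cis t)) /\<^sub>R (2 * pi) \<partial>lborel)"
  proof (rule integral_cong_AE)
    show "AE t in lborel. (indicator {0..<2 * pi} t / (2 * pi)) *\<^sub>R f (cis t) =
        (indicator {0..2 * pi} t *\<^sub>R f (cis t)) /\<^sub>R (2 * pi)"
      using AE_lborel_singleton[of "2 * pi"] by eventually_elim (auto simp: indicator_def field_simps)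
  qed auto
  also have "\<dots> = (\<integral>t. indicator {0..2 * pi} t *\<^sub>R f (cis t) \<partial>lborel) /\<^sub>R (2 * pi)"
    by (rule integral_scaleR_right)
  also have "(\<integral>t. indicator {0..2 * pi} t *\<^sub>R f (cis t) \<partial>lborel) = F (2 * pi) - F 0"
  proof (rule integral_FTC_Icc)
    show "continuous_on {0..2 * pi} (\<lambda>t. f (cis t))"
      by (intro continuous_on_compose2[OF assms(1)] continuous_intros) auto
  qed (auto intro!: has_vector_derivative_at_within F)
  finally show ?thesis by (simp add: scaleR_conv_of_real field_simps)
qed

lemma integral_unit_circle_uniform_power:
  assumes "m \<ge> 1"
  shows "(\<integral>z. z ^ m \<partial>unit_circle_uniform) = 0"
proof -
  have "((\<lambda>t. cis (real m * t) / (\<i> * m)) has_vector_derivative cis t ^ m) (at t)" for t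
  proof -
    have pow: "cis t ^ m = cis (real m * t)" by (rule Complex.DeMoivre)
    have cis: "cis (real m * x) = exp (\<i> * of_nat m * of_real x)" for x
      by (simp add: cis_conv_exp algebra_simps)
    have "((\<lambda>z. exp (\<i> * m * z) / (\<i> * m)) has_field_derivative exp (\<i> * m * of_real t)) (at (of_real t))"
      using assms by (auto intro!: derivative_eq_intros)
    from has_vector_derivative_real_field[OF this] show ?thesis
      unfolding pow cis .
  qed
  from integral_unit_circle_uniform[OF _ this] have
    "(\<integral>z. z ^ m \<partial>unit_circle_uniform) =
      (cis (real m * (2 * pi)) / (\<i> * m) - cis (real m * 0) / (\<i> * m)) / (2 * pi)"
    by (simp add: continuous_intros)
  also have "cis (real m * (2 * pi)) = 1"
    by (metis cis_multiple_2pi mult.commute Ints_of_nat)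
  finally show ?thesis by simp
qed

lemma integral_unit_circle_uniform_monomial:
  "(\<integral>z. z ^ a * cnj z ^ b \<partial>unit_circle_uniform) = (if a = b then 1 else 0)"
proof -
  interpret prob_space unit_circle_uniform by (rule prob_space_unit_circle_uniform)
  have le: "(\<integral>z. z ^ a * cnj z ^ b \<partial>unit_circle_uniform) = (if a = b then 1 else 0)" if "b \<le> a" for a b
  proof -
    have "(\<integral>z. z ^ a * cnj z ^ b \<partial>unit_circle_uniform) = (\<integral>z. z ^ (a - b) \<partial>unit_circle_uniform)"
    proof (rule integral_cong_AE)
      show "AE z in unit_circle_uniform. z ^ a * cnj z ^ b = z ^ (a - b)"
        using AE_unit_circle_uniform
      proof eventually_elim
        case (elim z)
        have "z ^ a * cnj z ^ b = z ^ (a - b) * (z * cnj z) ^ b"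
          using that by (simp add: power_mult_distrib flip: mult.assoc power_add)
        then show ?case using elim by (simp flip: complex_norm_square)
      qed
    qed (auto intro!: borel_measurable_continuous_onI continuous_intros simp: measurable_cong_sets[OF sets_unit_circle_uniform refl])
    also have "\<dots> = (if a = b then 1 else 0)"
      using integral_unit_circle_uniform_power[of "a - b"] that by (auto simp: prob_space)
    finally show ?thesis .
  qed
  show ?thesis
  proof (cases "b \<le> a")
    case False
    have "(\<integral>z. z ^ a * cnj z ^ b \<partial>unit_circle_uniform) = (\<integral>z. cnj (z ^ b * cnj z ^ a) \<partial>unit_circle_uniform)"
      by (simp add: mult.commute)
    also have "\<dots> = cnj (\<integral>z. z ^ b * cnj z ^ a \<partial>unit_circle_uniform)"
      by (rule Bochner_Integration.integral_cnj)
    finally show ?thesis using le[of a b] False by simp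
  qed (rule le)
qed

section \<open>Equidistribution of points in the unit disc\<close>

text \<open>
  Near the unit circle \<open>z (cnj z)\<close> is close to 1, so that mixed monomials reduce to pure powers. The error is
  Bernoulli's inequality for \<open>|z|\<^sup>2\<^sup>b\<close>, and it is linear in \<open>1 - |z|\<close>, hence survives averaging.
\<close>

lemma norm_monomial_diff_le:
  assumes "cmod z \<le> 1" "b \<le> a"
  shows "cmod (z ^ a * cnj z ^ b - z ^ (a - b)) \<le> 2 * real b * (1 - cmod z)"
proof -
  have "z ^ a * cnj z ^ b = z ^ (a - b) * (z * cnj z) ^ b"
    using assms(2) by (simp add: power_mult_distrib flip: mult.assoc power_add)
  also have "\<dots> = z ^ (a - b) * of_real (cmod z ^ (2 * b))"
    by (simp add: power_mult flip: complex_norm_square)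
  finally have "z ^ a * cnj z ^ b - z ^ (a - b) = z ^ (a - b) * of_real (cmod z ^ (2 * b) - 1)"
    by (simp add: algebra_simps)
  then have "cmod (z ^ a * cnj z ^ b - z ^ (a - b)) = cmod z ^ (a - b) * \<bar>cmod z ^ (2 * b) - 1\<bar>"
    by (simp only: norm_mult norm_power norm_of_real)
  also have "\<dots> \<le> 1 * \<bar>cmod z ^ (2 * b) - 1\<bar>"
    using assms by (intro mult_right_mono power_le_one) auto
  also have "\<dots> = 1 - cmod z ^ (2 * b)"
    using assms power_le_one[of "cmod z" "2 * b"] by simp
  also have "\<dots> \<le> 2 * real b * (1 - cmod z)"
    using Bernoulli_inequality[of "cmod z - 1" "2 * b"] by (simp add: algebra_simps)
  finally show ?thesis .
qed

lemma Weyl_criterion_disc_conj_polynomial: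
  fixes w :: "nat \<Rightarrow> nat \<Rightarrow> complex" and N :: "nat \<Rightarrow> nat"
  assumes N: "\<And>k. N k > 0"
    and disc: "\<And>k i. i < N k \<Longrightarrow> cmod (w k i) \<le> 1"
    and radial: "(\<lambda>k. (\<Sum>i<N k. 1 - cmod (w k i)) / N k) \<longlonglongrightarrow> 0"
    and moments: "\<And>m. m \<ge> 1 \<Longrightarrow> (\<lambda>k. (\<Sum>i<N k. w k i ^ m) / N k) \<longlonglongrightarrow> 0"
    and g: "conj_polynomial g"
  shows "continuous_on UNIV g \<and>
    (\<lambda>k. (\<Sum>i<N k. g (w k i)) / N k) \<longlonglongrightarrow> integral\<^sup>L unit_circle_uniform g"
  using g
proof (induction g)
  case (monomial c a b)
  have le: "(\<lambda>k. (\<Sum>i<N k. w k i ^ a * cnj (w k i) ^ b) / N k) \<longlonglongrightarrow> (if a = b then 1 else 0)"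
    if ab: "b \<le> a" for a b
  proof -
    let ?D = "\<lambda>k. (\<Sum>i<N k. w k i ^ a * cnj (w k i) ^ b - w k i ^ (a - b)) / N k"
    have "?D \<longlonglongrightarrow> 0"
    proof (rule Lim_null_comparison)
      have "cmod (?D k) \<le> 2 * real b * ((\<Sum>i<N k. 1 - cmod (w k i)) / N k)" for k
      proof -
        have "cmod (\<Sum>i<N k. w k i ^ a * cnj (w k i) ^ b - w k i ^ (a - b)) \<le>
            (\<Sum>i<N k. 2 * real b * (1 - cmod (w k i)))"
          using disc ab by (intro sum_norm_le norm_monomial_diff_le) auto
        then show ?thesis
          by (simp add: norm_divide divide_right_mono flip: sum_distrib_left)
      qed
      then show "\<forall>\<^sub>F k in sequentially. cmod (?D k) \<le> 2 * real b * ((\<Sum>i<N k. 1 - cmod (w k i)) / N k)"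
        by simp
      show "(\<lambda>k. 2 * real b * ((\<Sum>i<N k. 1 - cmod (w k i)) / N k)) \<longlonglongrightarrow> 0"
        using tendsto_mult_left[OF radial, of "2 * real b"] by simp
    qed
    moreover have "(\<lambda>k. (\<Sum>i<N k. w k i ^ (a - b)) / N k) \<longlonglongrightarrow> (if a = b then 1 else 0)"
      using moments[of "a - b"] ab N by (auto simp: less_imp_neq[symmetric])
    ultimately have "(\<lambda>k. ?D k + (\<Sum>i<N k. w k i ^ (a - b)) / N k) \<longlonglongrightarrow> 0 + (if a = b then 1 else 0)"
      by (rule tendsto_add)
    then show ?thesis by (simp add: sum_subtractf diff_divide_distrib)
  qed
  have "(\<lambda>k. (\<Sum>i<N k. w k i ^ a * cnj (w k i) ^ b) / N k) \<longlonglongrightarrow> (if a = b then 1 else 0)"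
  proof (cases "b \<le> a")
    case False
    then have "(\<lambda>k. cnj ((\<Sum>i<N k. w k i ^ b * cnj (w k i) ^ a) / N k)) \<longlonglongrightarrow> cnj 0"
      using le[of a b] by (intro tendsto_cnj) auto
    then show ?thesis using False by (simp add: mult.commute)
  qed (rule le)
  from tendsto_mult_left[OF this, of c] show ?case
    using integral_unit_circle_uniform_monomial[of a b]
    by (auto intro!: continuous_intros simp: mult.assoc sum_distrib_left)
next
  case (add f g)
  then show ?case
    using tendsto_add[of _ "integral\<^sup>L unit_circle_uniform f" sequentially _ "integral\<^sup>L unit_circle_uniform g"]
    by (auto intro!: continuous_intros simp: sum.distrib add_divide_distrib integrable_unit_circle_uniform)
qed

text \<open>
  A version of Weyl's equidistribution criterion for points of the closed unit disc: vanishing moments and a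
  vanishing mean distance to the unit circle force the empirical measures towards the uniform distribution.
  By Stone--Weierstrass on the disc it suffices to test polynomials in \<open>z\<close> and \<open>cnj z\<close>.
\<close>

theorem Weyl_criterion_disc:
  fixes w :: "nat \<Rightarrow> nat \<Rightarrow> complex" and N :: "nat \<Rightarrow> nat" and f :: "complex \<Rightarrow> real"
  assumes N: "\<And>k. N k > 0"
    and disc: "\<And>k i. i < N k \<Longrightarrow> cmod (w k i) \<le> 1"
    and radial: "(\<lambda>k. (\<Sum>i<N k. 1 - cmod (w k i)) / N k) \<longlonglongrightarrow> 0"
    and moments: "\<And>m. m \<ge> 1 \<Longrightarrow> (\<lambda>k. (\<Sum>i<N k. w k i ^ m) / N k) \<longlonglongrightarrow> 0"
    and f: "continuous_on UNIV f"
  shows "(\<lambda>k. (\<Sum>i<N k. f (w k i)) / N k) \<longlonglongrightarrow> integral\<^sup>L unit_circle_uniform f"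
proof (rule tendstoI)
  interpret prob_space unit_circle_uniform by (rule prob_space_unit_circle_uniform)
  fix e :: real assume e: "e > 0"
  obtain g where g: "real_polynomial_function g" and fg: "\<And>z. z \<in> cball 0 1 \<Longrightarrow> \<bar>f z - g z\<bar> < e / 3"
    using Stone_Weierstrass_real_polynomial_function[of "cball 0 1" f "e / 3"] e
      continuous_on_subset[OF f] by auto
  have gc: "continuous_on UNIV g"
    by (intro continuous_at_imp_continuous_on ballI continuous_real_polymonial_function g)
  let ?A = "\<lambda>f k. (\<Sum>i<N k. f (w k i)) / N k"
  have "(\<lambda>k. complex_of_real (?A g k)) \<longlonglongrightarrow> complex_of_real (integral\<^sup>L unit_circle_uniform g)"
    using Weyl_criterion_disc_conj_polynomial[OF N disc radial moments conj_polynomial_of_real[OF g]]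
    by simp
  then have "?A g \<longlonglongrightarrow> integral\<^sup>L unit_circle_uniform g"
    by (simp only: tendsto_of_real_iff)
  then have "\<forall>\<^sub>F k in sequentially. dist (?A g k) (integral\<^sup>L unit_circle_uniform g) < e / 3"
    by (rule tendstoD) (use e in simp)
  then show "\<forall>\<^sub>F k in sequentially. dist (?A f k) (integral\<^sup>L unit_circle_uniform f) < e"
  proof eventually_elim
    case (elim k)
    have "\<bar>\<Sum>i<N k. f (w k i) - g (w k i)\<bar> \<le> (\<Sum>i<N k. e / 3)"
      using disc fg by (intro order_trans[OF sum_abs] sum_mono less_imp_le) auto
    then have 1: "\<bar>?A f k - ?A g k\<bar> \<le> e / 3"
      using N[of k] by (simp add: sum_subtractf field_simps flip: diff_divide_distrib)
    have "\<bar>integral\<^sup>L unit_circle_uniform f - integral\<^sup>L unit_circle_uniform g\<bar> =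
        \<bar>\<integral>z. f z - g z \<partial>unit_circle_uniform\<bar>"
      by (simp add: integrable_unit_circle_uniform f gc)
    also have "\<dots> \<le> (\<integral>z. \<bar>f z - g z\<bar> \<partial>unit_circle_uniform)"
      by (rule integral_abs_bound)
    also have "\<dots> \<le> (\<integral>z. e / 3 \<partial>unit_circle_uniform)"
    proof (rule integral_mono_AE)
      show "AE z in unit_circle_uniform. \<bar>f z - g z\<bar> \<le> e / 3"
        using AE_unit_circle_uniform
      proof eventually_elim
        case (elim z)
        then show ?case using fg[of z] by simp
      qed
    qed (auto simp: integrable_unit_circle_uniform f gc)
    finally have 2: "\<bar>integral\<^sup>L unit_circle_uniform f - integral\<^sup>L unit_circle_uniform g\<bar> \<le> e / 3"
      by (simp add: prob_space)
    from 1 2 elim show ?case unfolding dist_real_def by linarith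
  qed
qed

text \<open>
  For a single test function and a single error, finitely many moments and one tolerance suffice. This is the
  form in which the criterion is applied to random points: it replaces convergence of a sequence by
  finitely many events.
\<close>

lemma Weyl_criterion_disc_uniform:
  fixes f :: "complex \<Rightarrow> real"
  assumes f: "continuous_on UNIV f" and e: "e > 0"
  obtains K :: nat and \<eta> :: real where "\<eta> > 0"
    "\<forall>N>0. \<forall>w :: nat \<Rightarrow> complex. (\<forall>i<N. cmod (w i) \<le> 1) \<longrightarrow> (\<Sum>i<N. 1 - cmod (w i)) / real N \<le> \<eta> \<longrightarrow>
      (\<forall>m\<in>{1..K}. cmod ((\<Sum>i<N. w i ^ m) / of_nat N) \<le> \<eta>) \<longrightarrow>
      \<bar>(\<Sum>i<N. f (w i)) / real N - integral\<^sup>L unit_circle_uniform f\<bar> \<le> e"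
proof (rule ccontr)
  assume no: "\<not> thesis"
  \<comment> \<open>Otherwise the tolerances \<open>1/(k+1)\<close> with \<open>k\<close> moments give a sequence that contradicts Weyl's criterion.\<close>
  define bad :: "nat \<Rightarrow> nat \<Rightarrow> (nat \<Rightarrow> complex) \<Rightarrow> bool" where "bad k N w \<longleftrightarrow>
      N > 0 \<and> (\<forall>i<N. cmod (w i) \<le> 1) \<and> (\<Sum>i<N. 1 - cmod (w i)) / N \<le> inverse (Suc k) \<and>
      (\<forall>m\<in>{1..k}. cmod ((\<Sum>i<N. w i ^ m) / N) \<le> inverse (Suc k)) \<and>
      \<not> \<bar>(\<Sum>i<N. f (w i)) / N - integral\<^sup>L unit_circle_uniform f\<bar> \<le> e" for k N w
  have "\<exists>N w. bad k N w" for k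
  proof (rule ccontr)
    assume none: "\<nexists>N w. bad k N w"
    have thesis
    proof (rule that[of "inverse (Suc k)" k])
      show "inverse (real (Suc k)) > 0" by simp
      show "\<forall>N>0. \<forall>w :: nat \<Rightarrow> complex. (\<forall>i<N. cmod (w i) \<le> 1) \<longrightarrow> (\<Sum>i<N. 1 - cmod (w i)) / real N \<le> inverse (real (Suc k)) \<longrightarrow>
      (\<forall>m\<in>{1..k}. cmod ((\<Sum>i<N. w i ^ m) / of_nat N) \<le> inverse (real (Suc k))) \<longrightarrow>
      \<bar>(\<Sum>i<N. f (w i)) / real N - integral\<^sup>L unit_circle_uniform f\<bar> \<le> e"
      proof (intro allI impI)
        fix N :: nat and w :: "nat \<Rightarrow> complex"
        assume w: "0 < N" "\<forall>i<N. cmod (w i) \<le> 1"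
          "(\<Sum>i<N. 1 - cmod (w i)) / real N \<le> inverse (real (Suc k))"
          "\<forall>m\<in>{1..k}. cmod ((\<Sum>i<N. w i ^ m) / of_nat N) \<le> inverse (real (Suc k))"
        show "\<bar>(\<Sum>i<N. f (w i)) / real N - integral\<^sup>L unit_circle_uniform f\<bar> \<le> e"
        proof (rule ccontr)
          assume "\<not> ?thesis"
          then have "bad k N w"
            unfolding bad_def using w by (intro conjI)
          with none show False by blast
        qed
      qed
    qed
    with no show False ..
  qed
  then obtain N w where bad: "\<And>k. bad k (N k) (w k)" by metis
  have N: "N k > 0" and disc: "i < N k \<Longrightarrow> cmod (w k i) \<le> 1"
    and rad: "(\<Sum>i<N k. 1 - cmod (w k i)) / N k \<le> inverse (Suc k)"
    and mom: "m \<in> {1..k} \<Longrightarrow> cmod ((\<Sum>i<N k. w k i ^ m) / N k) \<le> inverse (Suc k)"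
    and far: "\<not> \<bar>(\<Sum>i<N k. f (w k i)) / N k - integral\<^sup>L unit_circle_uniform f\<bar> \<le> e" for k i m
    using bad[of k] unfolding bad_def by blast+
  have "(\<lambda>k. (\<Sum>i<N k. f (w k i)) / N k) \<longlonglongrightarrow> integral\<^sup>L unit_circle_uniform f"
  proof (rule Weyl_criterion_disc[OF N disc _ _ f])
    show "(\<lambda>k. (\<Sum>i<N k. 1 - cmod (w k i)) / N k) \<longlonglongrightarrow> 0"
    proof (rule Lim_null_comparison[OF _ LIMSEQ_inverse_real_of_nat])
      have "(\<Sum>i<N k. 1 - cmod (w k i)) / N k \<ge> 0" for k
        using disc by (intro divide_nonneg_nonneg sum_nonneg) auto
      then show "\<forall>\<^sub>F k in sequentially. norm ((\<Sum>i<N k. 1 - cmod (w k i)) / N k) \<le> inverse (Suc k)"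
        using rad by (intro always_eventually) (simp only: real_norm_def abs_of_nonneg, blast)
    qed
    show "(\<lambda>k. (\<Sum>i<N k. w k i ^ m) / N k) \<longlonglongrightarrow> 0" if "m \<ge> 1" for m
    proof (rule Lim_null_comparison[OF _ LIMSEQ_inverse_real_of_nat])
      show "\<forall>\<^sub>F k in sequentially. cmod ((\<Sum>i<N k. w k i ^ m) / N k) \<le> inverse (Suc k)"
        using eventually_ge_at_top[of m] by eventually_elim (rule mom, use that in auto)
    qed
  qed
  from tendstoD[OF this e] far show False
    by (auto simp: dist_real_def eventually_sequentially not_le intro: less_asym)
qed

section \<open>Critical points of polynomials with zeros on the unit circle\<close>

lemma integral_root_measure:
  fixes f :: "complex \<Rightarrow> real"
  assumes p: "p \<noteq> 0" and f: "f \<in> borel_measurable borel"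
    and p_eq: "p = smult c (\<Prod>i\<in>I. [:- w i, 1:])" and I: "finite I"
  shows "integral\<^sup>L (root_measure p) f = (\<Sum>i\<in>I. f (w i)) / card I"
proof -
  let ?Z = "{z. poly p z = 0}"
  have fin: "finite ?Z" using p by (rule poly_roots_finite)
  have c: "c \<noteq> 0" using p p_eq by auto
  have deg: "degree p = card I" using c by (simp add: p_eq degree_prod_linear)
  have mult: "order z p = (\<Sum>i\<in>I. if w i = z then 1 else 0)" for z
  proof -
    have "proots p = (\<Sum>i\<in>I. {#w i#})"
      using c by (simp add: p_eq proots_prod)
    then have "count (proots p) z = (\<Sum>i\<in>I. count {#w i#} z)"
      by (simp add: count_sum)
    then show ?thesis using p by (auto intro: sum.cong)
  qed
  have root: "w i \<in> ?Z" if "i \<in> I" for i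
    using that I by (auto simp: p_eq poly_prod)
  have "integral\<^sup>L (root_measure p) f = integral\<^sup>L (point_measure ?Z (\<lambda>z. ennreal (real (order z p) / real (degree p)))) f"
    unfolding root_measure_def using f by (intro integral_distr) (auto simp: measurable_def space_point_measure sets_point_measure)
  also have "\<dots> = (\<Sum>z\<in>?Z. real (order z p) / real (degree p) * f z)"
    using fin by (subst lebesgue_integral_point_measure_finite) auto
  also have "\<dots> = (\<Sum>z\<in>?Z. \<Sum>i\<in>I. if w i = z then f z else 0) / card I"
    by (simp add: deg mult sum_distrib_right sum_divide_distrib if_distrib[where f = real] if_distribR cong: if_cong)
       (auto intro!: sum.cong)
  also have "(\<Sum>z\<in>?Z. \<Sum>i\<in>I. if w i = z then f z else 0) = (\<Sum>i\<in>I. \<Sum>z\<in>?Z. if w i = z then f z else 0)"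
    by (rule sum.swap)
  also have "\<dots> = (\<Sum>i\<in>I. f (w i))"
    using fin root by (intro sum.cong refl) (subst sum.delta', auto)
  finally show ?thesis .
qed

lemma linear_factorization:
  fixes p :: "'a :: alg_closed_field poly"
  assumes "p \<noteq> 0"
  obtains w :: "nat \<Rightarrow> 'a" where "p = smult (lead_coeff p) (\<Prod>i<degree p. [:- w i, 1:])"
proof -
  obtain A where A: "size A = degree p" "p = smult (lead_coeff p) (\<Prod>x\<in>#A. [:-x, 1:])"
    using alg_closed_imp_factorization[OF assms] by blast
  obtain xs where xs: "mset xs = A" using ex_mset by blast
  have "(\<Prod>x\<in>#A. [:-x, 1:]) = prod_list (map (\<lambda>x. [:-x, 1:]) xs)"
    by (metis mset_map prod_mset_prod_list xs)
  also have "\<dots> = (\<Prod>i<degree p. [:- xs ! i, 1:])"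
    using A(1) xs by (auto simp: prod.list_conv_set_nth atLeast0LessThan)
  finally show thesis using that[of "\<lambda>i. xs ! i"] A(2) by simp
qed

text \<open>
  For zeros on the unit circle \<open>|p(0)| = 1\<close>, so \<open>|p'(0)|\<close> is the modulus of \<open>\<Sum> 1 / z\<^sub>i = \<Sum> cnj z\<^sub>i\<close>; it is also
  \<open>n \<Prod>|w\<^sub>k|\<close>. Taking logarithms turns a lower bound for this sum into an upper bound for
  \<open>\<Sum> ln (1 / |w\<^sub>k|)\<close>, which dominates the total distance of the critical points from the circle.
\<close>

lemma critical_points_near_unit_circle:
  fixes z w :: "'i \<Rightarrow> complex"
  assumes fin: "finite I" "finite K"
    and fact: "pderiv (\<Prod>i\<in>I. [:- z i, 1:]) = smult (of_nat (card I)) (\<Prod>k\<in>K. [:- w k, 1:])"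
    and z: "\<And>i. i \<in> I \<Longrightarrow> cmod (z i) = 1"
    and S: "(\<Sum>i\<in>I. cnj (z i)) \<noteq> 0"
  shows "(\<Sum>k\<in>K. 1 - cmod (w k)) \<le> ln (card I / cmod (\<Sum>i\<in>I. cnj (z i)))"
proof -
  have z0: "0 \<noteq> z i" if "i \<in> I" for i using z[OF that] by auto
  have inv: "1 / (0 - z i) = - cnj (z i)" if "i \<in> I" for i
  proof -
    have "z i * cnj (z i) = 1" using z[OF that] by (simp flip: complex_norm_square)
    then show ?thesis using z0[OF that] by (simp add: field_simps)
  qed
  have "poly (pderiv (\<Prod>i\<in>I. [:- z i, 1:])) 0 = (\<Prod>i\<in>I. 0 - z i) * (\<Sum>i\<in>I. 1 / (0 - z i))"
    using fin(1) z0 by (rule poly_pderiv_prod_linear)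
  moreover have "cmod (\<Prod>i\<in>I. 0 - z i) = 1" by (simp add: z flip: prod_norm)
  ultimately have "cmod (poly (pderiv (\<Prod>i\<in>I. [:- z i, 1:])) 0) = cmod (\<Sum>i\<in>I. 1 / (0 - z i))"
    by (simp only: norm_mult mult_1)
  also have "(\<Sum>i\<in>I. 1 / (0 - z i)) = - (\<Sum>i\<in>I. cnj (z i))"
    by (simp only: inv sum_negf cong: sum.cong)
  finally have "cmod (\<Sum>i\<in>I. cnj (z i)) = card I * (\<Prod>k\<in>K. cmod (w k))"
    by (simp add: fact poly_prod norm_mult flip: prod_norm)
  moreover have card: "card I \<noteq> 0" and w: "\<And>k. k \<in> K \<Longrightarrow> cmod (w k) > 0"
  proof -
    have "real (card I) * (\<Prod>k\<in>K. cmod (w k)) \<noteq> 0"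
      unfolding calculation[symmetric] using S by simp
    then show "card I \<noteq> 0" "\<And>k. k \<in> K \<Longrightarrow> cmod (w k) > 0" using fin(2) by auto
  qed
  ultimately have "ln (card I / cmod (\<Sum>i\<in>I. cnj (z i))) = - ln (\<Prod>k\<in>K. cmod (w k))"
    using prod_pos[of K "\<lambda>k. cmod (w k)"] by (simp add: ln_div ln_mult)
  also have "\<dots> = (\<Sum>k\<in>K. - ln (cmod (w k)))"
    using fin(2) w by (simp add: ln_prod sum_negf)
  also have "\<dots> \<ge> (\<Sum>k\<in>K. 1 - cmod (w k))"
  proof (rule sum_mono)
    fix k assume "k \<in> K"
    then show "1 - cmod (w k) \<le> - ln (cmod (w k))"
      using ln_le_minus_one[OF w, of k] by linarith
  qed
  finally show ?thesis .
qed

text \<open>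
  The deterministic core. For large \<open>n\<close> the mean distance of the critical points from the circle is at most
  \<open>ln (n / \<delta>) / (n - 1)\<close>, and their moments differ from those of the zeros by a bounded amount divided by
  \<open>n - 1\<close>; hence the test function \<open>f\<close> sees them as equidistributed up to \<open>\<epsilon>\<close>.
\<close>

lemma integral_crit_measure_close:
  fixes f :: "complex \<Rightarrow> real"
  assumes f: "continuous_on UNIV f" and \<epsilon>: "\<epsilon> > 0" and \<delta>: "\<delta> > 0"
  obtains K :: nat and \<eta> :: real where "\<eta> > 0"
    "\<forall>\<^sub>F n in sequentially. \<forall>t. cmod (\<Sum>j=1..n. cis (- t j)) > \<delta> \<longrightarrow>
      (\<forall>m\<in>{1..K}. cmod ((\<Sum>j=1..n. cis (t j * real m)) / of_nat n) \<le> \<eta>) \<longrightarrow>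
      \<bar>integral\<^sup>L (crit_measure (circle_poly n t)) f - integral\<^sup>L unit_circle_uniform f\<bar> \<le> \<epsilon>"
proof -
  obtain K :: nat and \<eta> :: real where \<eta>: "\<eta> > 0" and
    close: "\<forall>N>0. \<forall>w :: nat \<Rightarrow> complex. (\<forall>i<N. cmod (w i) \<le> 1) \<longrightarrow> (\<Sum>i<N. 1 - cmod (w i)) / real N \<le> \<eta> \<longrightarrow>
      (\<forall>m\<in>{1..K}. cmod ((\<Sum>i<N. w i ^ m) / of_nat N) \<le> \<eta>) \<longrightarrow>
      \<bar>(\<Sum>i<N. f (w i)) / real N - integral\<^sup>L unit_circle_uniform f\<bar> \<le> \<epsilon>"
    by (rule Weyl_criterion_disc_uniform[OF f \<epsilon>])
  have "(\<lambda>n. ln (real n / \<delta>) / (real n - 1)) \<longlonglongrightarrow> 0"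
    using \<delta> by real_asymp
  then have ev1: "\<forall>\<^sub>F n in sequentially. ln (real n / \<delta>) / (real n - 1) < \<eta>"
    using \<eta> by (rule order_tendstoD)
  have "(\<lambda>n. 2 ^ (K + 1) / (real n - 1)) \<longlonglongrightarrow> 0"
    by real_asymp
  then have ev2: "\<forall>\<^sub>F n in sequentially. 2 ^ (K + 1) / (real n - 1) < \<eta> / 2"
    using \<eta> by (intro order_tendstoD) auto
  \<comment> \<open>Half of the tolerance \<open>\<eta>\<close> pays for passing from zeros to critical points;
    the other half covers \<open>\<eta> / 4\<close> times \<open>n / (n - 1) \<le> 2\<close>.\<close>
  have "\<forall>\<^sub>F n in sequentially. \<forall>t. cmod (\<Sum>j=1..n. cis (- t j)) > \<delta> \<longrightarrow>
      (\<forall>m\<in>{1..K}. cmod ((\<Sum>j=1..n. cis (t j * real m)) / of_nat n) \<le> \<eta> / 4) \<longrightarrow>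
      \<bar>integral\<^sup>L (crit_measure (circle_poly n t)) f - integral\<^sup>L unit_circle_uniform f\<bar> \<le> \<epsilon>"
    using ev1 ev2 eventually_ge_at_top[of 2]
  proof (eventually_elim, intro allI impI)
    fix n t
    assume n1: "ln (real n / \<delta>) / (real n - 1) < \<eta>" and n2: "2 ^ (K + 1) / (real n - 1) < \<eta> / 2"
      and n: "2 \<le> n" and S: "cmod (\<Sum>j=1..n. cis (- t j)) > \<delta>"
      and mom: "\<forall>m\<in>{1..K}. cmod ((\<Sum>j=1..n. cis (t j * real m)) / of_nat n) \<le> \<eta> / 4"
    define N where "N = n - 1"
    have N: "N > 0" "n = Suc N" "real n - 1 = real N" using n by (auto simp: N_def)
    let ?z = "\<lambda>j. cis (t j)"
    let ?p = "circle_poly n t"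
    have p: "?p = (\<Prod>j\<in>{1..n}. [:- ?z j, 1:])" by (simp add: circle_poly_def)
    have deg: "degree ?p = n" unfolding p degree_prod_linear by simp
    have monic: "lead_coeff ?p = 1" unfolding p lead_coeff_prod by simp
    have p'0: "pderiv ?p \<noteq> 0" using deg n by (simp add: pderiv_eq_0_iff)
    have deg': "degree (pderiv ?p) = N" by (simp add: degree_pderiv deg N_def)
    have "lead_coeff (pderiv ?p) = of_nat n"
      unfolding deg' coeff_pderiv N(2)[symmetric] using monic deg by simp
    then obtain w where w: "pderiv ?p = smult (of_nat n) (\<Prod>i<N. [:- w i, 1:])"
      using linear_factorization[OF p'0] unfolding deg' by metis
    have fact: "pderiv (\<Prod>j\<in>{1..n}. [:- ?z j, 1:]) = smult (of_nat (card {1..n})) (\<Prod>i\<in>{..<N}. [:- w i, 1:])"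
      using w by (simp add: p)
    have "integral\<^sup>L (crit_measure ?p) f = (\<Sum>i<N. f (w i)) / card {..<N}"
      unfolding crit_measure_def
      by (rule integral_root_measure[OF p'0 _ w]) (use f borel_measurable_continuous_onI in auto)
    moreover have "\<bar>(\<Sum>i<N. f (w i)) / N - integral\<^sup>L unit_circle_uniform f\<bar> \<le> \<epsilon>"
    proof (rule close[rule_format, OF N(1)])
      show "cmod (w i) \<le> 1" if "i < N" for i
      proof (rule Gauss_Lucas_unit_disc)
        show "poly (pderiv (\<Prod>j\<in>{1..n}. [:- ?z j, 1:])) (w i) = 0"
          unfolding fact using that by (auto simp: poly_prod)
      qed (use n in auto)
      have S': "cmod (\<Sum>j\<in>{1..n}. cnj (?z j)) > \<delta>" using S by (simp add: cis_cnj)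
      have "(\<Sum>i<N. 1 - cmod (w i)) \<le> ln (card {1..n} / cmod (\<Sum>j\<in>{1..n}. cnj (?z j)))"
        using S' \<delta> by (intro critical_points_near_unit_circle[OF _ _ fact]) auto
      also have "\<dots> \<le> ln (real n / \<delta>)"
        using S' \<delta> n by (subst ln_le_cancel_iff) (auto intro!: divide_left_mono divide_pos_pos mult_pos_pos)
      finally have "(\<Sum>i<N. 1 - cmod (w i)) / N \<le> ln (real n / \<delta>) / N"
        by (rule divide_right_mono) simp
      then show "(\<Sum>i<N. 1 - cmod (w i)) / N \<le> \<eta>" using n1 unfolding N(3) by linarith
      show "cmod ((\<Sum>i<N. w i ^ m) / N) \<le> \<eta>" if m: "m \<in> {1..K}" for m
      proof -
        let ?P = "\<Sum>j\<in>{1..n}. ?z j ^ m" and ?Q = "\<Sum>i\<in>{..<N}. w i ^ m"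
        have P: "?P = (\<Sum>j=1..n. cis (t j * real m))"
          by (simp add: Complex.DeMoivre mult.commute)
        have "cmod ?P \<le> \<eta> / 4 * n"
          using bspec[OF mom m] n unfolding P by (simp add: norm_divide field_simps)
        also have "\<dots> \<le> \<eta> / 4 * (2 * N)" using N \<eta> by (intro mult_left_mono) auto
        finally have 1: "cmod ?P \<le> \<eta> / 2 * N" by simp
        have "cmod (?Q - ?P) \<le> 2 ^ (m + 1) - 1"
          using N(2) by (intro power_sum_critical_points_diff_le[OF _ _ _ fact]) auto
        also have "\<dots> \<le> 2 ^ (K + 1)"
        proof -
          have "(2 :: real) ^ (m + 1) \<le> 2 ^ (K + 1)" using m by (intro power_increasing) auto
          then show ?thesis by linarith
        qed
        also have "\<dots> \<le> \<eta> / 2 * N"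
          using n2 N(1) unfolding N(3) by (simp add: field_simps)
        finally have "cmod ?Q \<le> \<eta> * N"
          using 1 norm_triangle_ineq[of ?P "?Q - ?P"] by simp
        then show ?thesis using N(1) by (simp add: norm_divide field_simps)
      qed
    qed
    ultimately show "\<bar>integral\<^sup>L (crit_measure ?p) f - integral\<^sup>L unit_circle_uniform f\<bar> \<le> \<epsilon>"
      by simp
  qed
  with \<eta> that[of "\<eta> / 4" K] show thesis by simp
qed

section \<open>Convergence in probability\<close>

theorem theorem11:
  fixes M :: "nat \<Rightarrow> 'a measure"
    and \<theta> :: "nat \<Rightarrow> nat \<Rightarrow> 'a \<Rightarrow> real"
  assumes prob: "\<And>n. n \<ge> 1 \<Longrightarrow> prob_space (M n)"
    and rv: "\<And>n j. n \<ge> 1 \<Longrightarrow> j \<in> {1..n} \<Longrightarrow> \<theta> n j \<in> borel_measurable (M n)"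
    and range: "\<And>n j \<omega>. n \<ge> 1 \<Longrightarrow> j \<in> {1..n} \<Longrightarrow> \<omega> \<in> space (M n) \<Longrightarrow> \<theta> n j \<omega> \<in> {0..<2 * pi}"
    and i: "no_mass_near_zero M (\<lambda>n \<omega>. \<Sum>j=1..n. cis (- \<theta> n j \<omega>))"
    and ii: "AE z\<in>ball (0 :: complex) 1 in lborel.
      no_mass_near_zero M (\<lambda>n \<omega>. \<Sum>m=0..nat \<lfloor>(ln (real n))\<^sup>2\<rfloor>.
        z ^ m * (\<Sum>j=1..n. cis (- (\<theta> n j \<omega> * real (m + 1)))))"
    and iii: "\<And>m :: nat. m \<ge> 1 \<Longrightarrow>
      tends_to_zero_in_prob M (\<lambda>n \<omega>. (\<Sum>j=1..n. cis (\<theta> n j \<omega> * real m)) / of_nat n)"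
  shows "converges_weakly_in_prob M
    (\<lambda>n \<omega>. crit_measure (circle_poly n (\<lambda>j. \<theta> n j \<omega>))) unit_circle_uniform"
  unfolding converges_weakly_in_prob_def
proof (intro allI impI tendstoI)
  fix f :: "complex \<Rightarrow> real" and \<epsilon> \<tau> :: real
  assume f: "continuous_on UNIV f" and \<epsilon>: "\<epsilon> > 0" and \<tau>: "\<tau> > 0"
  let ?far = "\<lambda>n. {\<omega> \<in> space (M n). \<bar>integral\<^sup>L (crit_measure (circle_poly n (\<lambda>j. \<theta> n j \<omega>))) f
    - integral\<^sup>L unit_circle_uniform f\<bar> > \<epsilon>}"
  let ?small = "\<lambda>\<delta> n. {\<omega> \<in> space (M n). cmod (\<Sum>j=1..n. cis (- \<theta> n j \<omega>)) \<le> \<delta>}"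
  let ?big = "\<lambda>\<eta> m n. {\<omega> \<in> space (M n). cmod ((\<Sum>j=1..n. cis (\<theta> n j \<omega> * real m)) / of_nat n) > \<eta>}"
  have "\<forall>\<^sub>F \<delta> in at_right 0. limsup (\<lambda>n. ereal (measure (M n) (?small \<delta> n))) < ereal (\<tau> / 2)"
    using i[unfolded no_mass_near_zero_def] by (rule order_tendstoD) (use \<tau> in simp)
  then have "\<forall>\<^sub>F \<delta> in at_right 0. \<delta> > 0 \<and> limsup (\<lambda>n. ereal (measure (M n) (?small \<delta> n))) < ereal (\<tau> / 2)"
    using eventually_at_right_less by (rule eventually_elim2) auto
  then obtain \<delta> :: real where \<delta>: "\<delta> > 0"
    and limsup: "limsup (\<lambda>n. ereal (measure (M n) (?small \<delta> n))) < ereal (\<tau> / 2)"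
    using eventually_happens'[OF trivial_limit_at_right_real] by blast
  have ev1: "\<forall>\<^sub>F n in sequentially. measure (M n) (?small \<delta> n) < \<tau> / 2"
    using Limsup_lessD[OF limsup] by simp
  obtain K :: nat and \<eta> :: real where \<eta>: "\<eta> > 0" and
    close: "\<forall>\<^sub>F n in sequentially. \<forall>t. cmod (\<Sum>j=1..n. cis (- t j)) > \<delta> \<longrightarrow>
      (\<forall>m\<in>{1..K}. cmod ((\<Sum>j=1..n. cis (t j * real m)) / of_nat n) \<le> \<eta>) \<longrightarrow>
      \<bar>integral\<^sup>L (crit_measure (circle_poly n t)) f - integral\<^sup>L unit_circle_uniform f\<bar> \<le> \<epsilon>"
    by (rule integral_crit_measure_close[OF f \<epsilon> \<delta>])
  have "(\<lambda>n. \<Sum>m\<in>{1..K}. measure (M n) (?big \<eta> m n)) \<longlonglongrightarrow> (\<Sum>m\<in>{1..K}. 0)"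
    using iii \<eta> unfolding tends_to_zero_in_prob_def by (intro tendsto_sum) auto
  then have ev2: "\<forall>\<^sub>F n in sequentially. (\<Sum>m\<in>{1..K}. measure (M n) (?big \<eta> m n)) < \<tau> / 2"
    by (rule order_tendstoD) (use \<tau> in simp)
  show "\<forall>\<^sub>F n in sequentially. dist (measure (M n) (?far n)) 0 < \<tau>"
    using ev1 ev2 close eventually_ge_at_top[of 1]
  proof eventually_elim
    case (elim n)
    interpret prob_space "M n" using elim(4) by (rule prob)
    have cis: "(\<lambda>\<omega>. cis (c * \<theta> n j \<omega>)) \<in> borel_measurable (M n)" if "j \<in> {1..n}" for c j
      by (intro measurable_compose[OF _ cis_measurable] borel_measurable_times borel_measurable_const rv elim(4) that)
    have small: "?small \<delta> n \<in> sets (M n)"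
    proof -
      have "(\<lambda>\<omega>. \<Sum>j=1..n. cis (- 1 * \<theta> n j \<omega>)) \<in> borel_measurable (M n)"
        by (intro borel_measurable_sum cis)
      then show ?thesis by simp
    qed
    have big: "?big \<eta> m n \<in> sets (M n)" for m
    proof -
      have "(\<lambda>\<omega>. \<Sum>j=1..n. cis (real m * \<theta> n j \<omega>)) \<in> borel_measurable (M n)"
        by (intro borel_measurable_sum cis)
      then show ?thesis by (simp add: mult.commute)
    qed
    \<comment> \<open>The event on the left need not be known to be measurable: a measurable superset bounds its measure.\<close>
    have "?far n \<subseteq> ?small \<delta> n \<union> (\<Union>m\<in>{1..K}. ?big \<eta> m n)"
    proof
      fix \<omega> assume \<omega>: "\<omega> \<in> ?far n"
      show "\<omega> \<in> ?small \<delta> n \<union> (\<Union>m\<in>{1..K}. ?big \<eta> m n)"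
      proof (rule ccontr)
        assume "\<not> ?thesis"
        then have "cmod (\<Sum>j=1..n. cis (- \<theta> n j \<omega>)) > \<delta>"
          and "\<forall>m\<in>{1..K}. cmod ((\<Sum>j=1..n. cis (\<theta> n j \<omega> * real m)) / of_nat n) \<le> \<eta>"
          using \<omega> by (auto simp: not_le not_less)
        with elim(3)[rule_format, of "\<lambda>j. \<theta> n j \<omega>"] \<omega> show False by auto
      qed
    qed
    then have "measure (M n) (?far n) \<le> measure (M n) (?small \<delta> n \<union> (\<Union>m\<in>{1..K}. ?big \<eta> m n))"
      by (rule finite_measure_mono) (use small big in auto)
    also have "\<dots> \<le> measure (M n) (?small \<delta> n) + measure (M n) (\<Union>m\<in>{1..K}. ?big \<eta> m n)"
      by (rule measure_Un_le) (use small big in auto)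
    also have "measure (M n) (\<Union>m\<in>{1..K}. ?big \<eta> m n) \<le> (\<Sum>m\<in>{1..K}. measure (M n) (?big \<eta> m n))"
      by (rule measure_UNION_le) (use big in auto)
    finally show ?case using elim(1,2) by simp
  qed
qed

end
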